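(* Let $(X,\mathcal{A},\mu)$ be a measure space with $\mu(X)>0$ such that $X$ is not an atom. Then the girth of the comaximal graph is $$gr(\Gamma'_2(\mathcal{M}(X,\mathcal{A})))=\begin{cases}4&\text{if }X\text{ is partitioned into two atoms},\\ 3&\text{otherwise,}\end{cases}$$ where "$X$ is partitioned into two atoms" means $X=A\sqcup B$ for some atoms $A,B\in\mathcal{A}$.
   Context: $\mathcal{M}(X,\mathcal{A})$ is the commutative ring (pointwise operations) of all $\mathcal{A}$-measurable functions $f:X\to\mathbb{R}$; $Z(f)=\{x\in X:f(x)=0\}$. A set $A\in\mathcal{A}$ is an atom if $\mu(A)>0$ and $A$ cannot be written as a disjoint union $A=B\sqcup C$ with $B,C\in\mathcal{A}$, $\mu(B)>0$, $\mu(C)>0$. A function $u\in\mathcal{M}(X,\mathcal{A})$ is a $\mu$-unit if $\mu(Z(u))=0$. Write $\mathscr{D}=\{f\in\mathcal{M}(X,\mathcal{A}):\mu(Z(f))>0\text{ and }\mu(X\setminus Z(f))>0\}$, i.e. the functions that are neither $\mu$-units nor equal to $0$ almost everywhere. The comaximal graph $\Gamma'_2(\mathcal{M}(X,\mathcal{A}))$ is the simple graph with vertex set $\mathscr{D}$ in which distinct $f,g$ are adjacent iff the sum of principal ideals $\langle f\rangle+\langle g\rangle$ equals $\langle u\rangle$ for some $\mu$-unit $u$. The girth of a graph is the length of its shortest cycle. *)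

theory Defs
  imports
    "HOL-Analysis.Measure_Space"
    "HOL-Analysis.Borel_Space"
    "HOL-Algebra.Ideal"
    "HOL-Library.Extended_Nat"
    "Graph_Theory.Pair_Digraph"
begin

text \<open>The underlying set of \<open>M\<close> need not be the whole type. Elements of the ring are therefore
  taken to be extensional, so that equality in the ring is equality of functions on \<open>space M\<close>.\<close>

definition meas_ring :: "'a measure \<Rightarrow> ('a \<Rightarrow> real) ring" where
  "meas_ring M =
    \<lparr>carrier = borel_measurable M \<inter> extensional (space M),
     mult = (\<lambda>f g. \<lambda>x\<in>space M. f x * g x),
     one = (\<lambda>x\<in>space M. 1),
     zero = (\<lambda>x\<in>space M. 0),
     add = (\<lambda>f g. \<lambda>x\<in>space M. f x + g x)\<rparr>"

lemma restrict_in_meas_ring: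
  "f \<in> borel_measurable M \<Longrightarrow> restrict f (space M) \<in> carrier (meas_ring M)"
  by (simp add: meas_ring_def measurable_restrict_space1 cong: measurable_cong)

lemma cring_meas_ring: "cring (meas_ring M)"
proof (rule cringI)
  show "abelian_group (meas_ring M)"
  proof (rule abelian_groupI)
    fix f assume f: "f \<in> carrier (meas_ring M)"
    have "(\<lambda>x\<in>space M. - f x) \<in> carrier (meas_ring M)"
      using f by (intro restrict_in_meas_ring) (simp add: meas_ring_def)
    moreover have "(\<lambda>x\<in>space M. - f x) \<oplus>\<^bsub>meas_ring M\<^esub> f = \<zero>\<^bsub>meas_ring M\<^esub>"
      by (auto simp: meas_ring_def fun_eq_iff)
    ultimately show "\<exists>g\<in>carrier (meas_ring M). g \<oplus>\<^bsub>meas_ring M\<^esub> f = \<zero>\<^bsub>meas_ring M\<^esub>"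
      by blast
  qed (auto simp: meas_ring_def fun_eq_iff extensional_def restrict_def cong: measurable_cong)
  show "Group.comm_monoid (meas_ring M)"
    by (rule comm_monoidI)
      (auto simp: meas_ring_def fun_eq_iff extensional_def restrict_def cong: measurable_cong)
qed (auto simp: meas_ring_def fun_eq_iff restrict_def distrib_right)

definition zero_set :: "'a measure \<Rightarrow> ('a \<Rightarrow> real) \<Rightarrow> 'a set" where
  "zero_set M f = {x \<in> space M. f x = 0}"

definition atom :: "'a measure \<Rightarrow> 'a set \<Rightarrow> bool" where
  "atom M A \<longleftrightarrow> A \<in> sets M \<and> emeasure M A > 0 \<and>
    \<not> (\<exists>B\<in>sets M. \<exists>C\<in>sets M.
        A = B \<union> C \<and> B \<inter> C = {} \<and> emeasure M B > 0 \<and> emeasure M C > 0)"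

definition mu_unit :: "'a measure \<Rightarrow> ('a \<Rightarrow> real) \<Rightarrow> bool" where
  "mu_unit M u \<longleftrightarrow> u \<in> carrier (meas_ring M) \<and> emeasure M (zero_set M u) = 0"

definition graph_vertices :: "'a measure \<Rightarrow> ('a \<Rightarrow> real) set" where
  "graph_vertices M = {f \<in> carrier (meas_ring M).
    emeasure M (zero_set M f) > 0 \<and> emeasure M (space M - zero_set M f) > 0}"

text \<open>A possibly infinite simple graph is represented by the digraph having both arcs
  \<open>(v, w)\<close> and \<open>(w, v)\<close> for each edge, that is, by a \<open>pair_bidirected_digraph\<close>.\<close>

definition comaximal_graph :: "'a measure \<Rightarrow> ('a \<Rightarrow> real) pair_pre_digraph" where
  "comaximal_graph M =
    \<lparr>pverts = graph_vertices M,
     parcs = {(f, g). f \<in> graph_vertices M \<and> g \<in> graph_vertices M \<and> f \<noteq> g \<and>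
       (\<exists>u. mu_unit M u \<and>
         PIdl\<^bsub>meas_ring M\<^esub> f <+>\<^bsub>meas_ring M\<^esub> PIdl\<^bsub>meas_ring M\<^esub> g = PIdl\<^bsub>meas_ring M\<^esub> u)}\<rparr>"

lemma pair_bidirected_comaximal_graph: "pair_bidirected_digraph (comaximal_graph M)"
proof -
  interpret cring "meas_ring M"
    by (rule cring_meas_ring)
  have "PIdl\<^bsub>meas_ring M\<^esub> f <+>\<^bsub>meas_ring M\<^esub> PIdl\<^bsub>meas_ring M\<^esub> g
      = PIdl\<^bsub>meas_ring M\<^esub> g <+>\<^bsub>meas_ring M\<^esub> PIdl\<^bsub>meas_ring M\<^esub> f"
    if "f \<in> graph_vertices M" "g \<in> graph_vertices M" for f g
    using that by (intro set_add_comm) (auto simp: graph_vertices_def cgenideal_def)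
  then show ?thesis
    by unfold_locales (auto simp: comaximal_graph_def symmetric_def sym_def)
qed

text \<open>\<open>pre_digraph.cycle\<close> is the notion for digraphs, which admits the closed walk \<open>v, w, v\<close>
  of length 2 along a single edge. In a \<open>pair_bidirected_digraph\<close> the directed cycles of length
  at least 3 are exactly the cycles of the simple graph. A graph without cycles has girth \<open>\<infinity>\<close>.\<close>

definition girth :: "'v pair_pre_digraph \<Rightarrow> enat" where
  "girth G = (INF p \<in> {p. pre_digraph.cycle (with_proj G) p \<and> 3 \<le> length p}. enat (length p))"

end

theory Submission
  imports Defs
begin

text \<open>Since quotients of measurable functions (with \<open>x / 0 = 0\<close>) are measurable, a finitely
  generated ideal consists of all functions vanishing on the common zero set of its generators.
  Hence two vertices are adjacent iff their zero sets meet in a null set. If the space splits into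
  two atoms, then each zero set contains almost all of one of them, so by the pigeonhole principle
  there is no triangle, while two characteristic functions and their doubles form a 4-cycle.
  Otherwise the space splits into three sets of positive measure, which are the zero sets of the
  vertices of a triangle.\<close>

section \<open>Principal ideals and their sums\<close>

lemma mem_PIdl_meas_ring_iff:
  assumes f: "f \<in> carrier (meas_ring M)"
  shows "h \<in> PIdl\<^bsub>meas_ring M\<^esub> f \<longleftrightarrow>
    h \<in> carrier (meas_ring M) \<and> zero_set M f \<subseteq> zero_set M h"
proof
  assume "h \<in> PIdl\<^bsub>meas_ring M\<^esub> f"
  then obtain a where a: "a \<in> carrier (meas_ring M)" and h: "h = a \<otimes>\<^bsub>meas_ring M\<^esub> f"
    by (auto simp: cgenideal_def)
  interpret cring "meas_ring M" by (rule cring_meas_ring)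
  show "h \<in> carrier (meas_ring M) \<and> zero_set M f \<subseteq> zero_set M h"
    using m_closed[OF a f] by (auto simp: h meas_ring_def zero_set_def)
next
  assume h: "h \<in> carrier (meas_ring M) \<and> zero_set M f \<subseteq> zero_set M h"
  \<comment> \<open>Where \<open>f\<close> vanishes, so does \<open>h\<close>, and division by 0
    gives 0; hence the product \<open>?a\<close> times \<open>f\<close> is \<open>h\<close> on all
    of \<open>space M\<close>.\<close>
  let ?a = "\<lambda>x\<in>space M. h x / f x"
  have "?a \<in> carrier (meas_ring M)"
    using f h by (intro restrict_in_meas_ring) (auto simp: meas_ring_def)
  moreover have "h = ?a \<otimes>\<^bsub>meas_ring M\<^esub> f"
    using h by (auto simp: meas_ring_def zero_set_def fun_eq_iff restrict_def extensional_def)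
  ultimately show "h \<in> PIdl\<^bsub>meas_ring M\<^esub> f"
    by (auto simp: cgenideal_def)
qed

lemma mem_PIdl_add_PIdl_meas_ring_iff:
  assumes f: "f \<in> carrier (meas_ring M)" and g: "g \<in> carrier (meas_ring M)"
  shows "h \<in> PIdl\<^bsub>meas_ring M\<^esub> f <+>\<^bsub>meas_ring M\<^esub> PIdl\<^bsub>meas_ring M\<^esub> g \<longleftrightarrow>
    h \<in> carrier (meas_ring M) \<and> zero_set M f \<inter> zero_set M g \<subseteq> zero_set M h"
proof
  assume "h \<in> PIdl\<^bsub>meas_ring M\<^esub> f <+>\<^bsub>meas_ring M\<^esub> PIdl\<^bsub>meas_ring M\<^esub> g"
  then obtain a b where "a \<in> PIdl\<^bsub>meas_ring M\<^esub> f" "b \<in> PIdl\<^bsub>meas_ring M\<^esub> g"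
    and h: "h = a \<oplus>\<^bsub>meas_ring M\<^esub> b"
    by (auto simp: set_add_def')
  then have a: "a \<in> carrier (meas_ring M)" "zero_set M f \<subseteq> zero_set M a"
    and b: "b \<in> carrier (meas_ring M)" "zero_set M g \<subseteq> zero_set M b"
    using f g by (auto simp: mem_PIdl_meas_ring_iff)
  interpret cring "meas_ring M" by (rule cring_meas_ring)
  show "h \<in> carrier (meas_ring M) \<and> zero_set M f \<inter> zero_set M g \<subseteq> zero_set M h"
    using a_closed[OF a(1) b(1)] a(2) b(2) by (auto simp: h meas_ring_def zero_set_def subset_iff)
next
  assume h: "h \<in> carrier (meas_ring M) \<and> zero_set M f \<inter> zero_set M g \<subseteq> zero_set M h"
  \<comment> \<open>A sum of real squares vanishes only at common zeros of \<open>f\<close> and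
    \<open>g\<close>, where \<open>h\<close> is 0 by assumption. Weighting \<open>?q\<close> by the
    two squares splits \<open>h\<close> into one summand that vanishes with \<open>f\<close> and one
    that vanishes with \<open>g\<close>.\<close>
  let ?q = "\<lambda>x. h x / ((f x)\<^sup>2 + (g x)\<^sup>2)"
  let ?a = "\<lambda>x\<in>space M. (f x)\<^sup>2 * ?q x" and ?b = "\<lambda>x\<in>space M. (g x)\<^sup>2 * ?q x"
  have "?a \<in> carrier (meas_ring M)" "?b \<in> carrier (meas_ring M)"
    using f g h by (intro restrict_in_meas_ring; auto simp: meas_ring_def)+
  moreover have "h = ?a \<oplus>\<^bsub>meas_ring M\<^esub> ?b"
  proof
    fix x
    show "h x = (?a \<oplus>\<^bsub>meas_ring M\<^esub> ?b) x"
    proof (cases "x \<in> space M")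
      case True
      have "(f x)\<^sup>2 * ?q x + (g x)\<^sup>2 * ?q x = ((f x)\<^sup>2 + (g x)\<^sup>2) * ?q x"
        by (rule distrib_right[symmetric])
      also have "\<dots> = h x"
        using h True by (auto simp: zero_set_def sum_power2_eq_zero_iff)
      finally show ?thesis
        using True by (simp add: meas_ring_def)
    next
      case False
      then show ?thesis
        using h by (auto simp: meas_ring_def extensional_def)
    qed
  qed
  ultimately show "h \<in> PIdl\<^bsub>meas_ring M\<^esub> f <+>\<^bsub>meas_ring M\<^esub> PIdl\<^bsub>meas_ring M\<^esub> g"
    using f g by (force simp: set_add_def' mem_PIdl_meas_ring_iff zero_set_def)
qed

lemma zero_set_in_sets:
  "f \<in> carrier (meas_ring M) \<Longrightarrow> zero_set M f \<in> sets M"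
  by (auto simp: meas_ring_def zero_set_def)

text \<open>The sum of the two ideals is always principal: \<open>f\<close> squared plus
  \<open>g\<close> squared generates it and has the common zero set as its own. Conversely, any
  generator must vanish on the common zero set, so a \<open>mu_unit\<close> generator forces that
  set to be null.\<close>

lemma comaximal_iff:
  assumes f: "f \<in> carrier (meas_ring M)" and g: "g \<in> carrier (meas_ring M)"
  shows "(\<exists>u. mu_unit M u \<and>
      PIdl\<^bsub>meas_ring M\<^esub> f <+>\<^bsub>meas_ring M\<^esub> PIdl\<^bsub>meas_ring M\<^esub> g = PIdl\<^bsub>meas_ring M\<^esub> u) \<longleftrightarrow>
    emeasure M (zero_set M f \<inter> zero_set M g) = 0"
proof
  assume "\<exists>u. mu_unit M u \<and>
      PIdl\<^bsub>meas_ring M\<^esub> f <+>\<^bsub>meas_ring M\<^esub> PIdl\<^bsub>meas_ring M\<^esub> g = PIdl\<^bsub>meas_ring M\<^esub> u"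
  then obtain u where u: "mu_unit M u"
    and eq: "PIdl\<^bsub>meas_ring M\<^esub> f <+>\<^bsub>meas_ring M\<^esub> PIdl\<^bsub>meas_ring M\<^esub> g = PIdl\<^bsub>meas_ring M\<^esub> u"
    by blast
  have "u \<in> PIdl\<^bsub>meas_ring M\<^esub> u"
    using u by (simp add: mem_PIdl_meas_ring_iff mu_unit_def)
  then have "zero_set M f \<inter> zero_set M g \<subseteq> zero_set M u"
    using f g by (simp flip: eq add: mem_PIdl_add_PIdl_meas_ring_iff)
  then show "emeasure M (zero_set M f \<inter> zero_set M g) = 0"
    using u by (metis emeasure_eq_0 mu_unit_def zero_set_in_sets)
next
  assume null: "emeasure M (zero_set M f \<inter> zero_set M g) = 0"
  let ?u = "\<lambda>x\<in>space M. (f x)\<^sup>2 + (g x)\<^sup>2"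
  have u: "?u \<in> carrier (meas_ring M)"
    using f g by (intro restrict_in_meas_ring) (auto simp: meas_ring_def)
  have Z: "zero_set M ?u = zero_set M f \<inter> zero_set M g"
    by (auto simp: zero_set_def sum_power2_eq_zero_iff)
  show "\<exists>u. mu_unit M u \<and>
      PIdl\<^bsub>meas_ring M\<^esub> f <+>\<^bsub>meas_ring M\<^esub> PIdl\<^bsub>meas_ring M\<^esub> g = PIdl\<^bsub>meas_ring M\<^esub> u"
    using null u
    by (intro exI[of _ ?u])
      (auto simp: mu_unit_def Z mem_PIdl_meas_ring_iff mem_PIdl_add_PIdl_meas_ring_iff f g
        set_eq_iff)
qed

text \<open>The clause \<open>f \<noteq> g\<close> is absorbed: for \<open>f = g\<close> the
  intersection is \<open>zero_set M f\<close>, which is not null for a vertex.\<close>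

lemma parcs_comaximal_graph_iff:
  "(f, g) \<in> parcs (comaximal_graph M) \<longleftrightarrow> f \<in> graph_vertices M \<and> g \<in> graph_vertices M \<and>
    emeasure M (zero_set M f \<inter> zero_set M g) = 0"
  using comaximal_iff[of f M g] by (auto simp: comaximal_graph_def graph_vertices_def)

lemma pverts_comaximal_graph [simp]: "pverts (comaximal_graph M) = graph_vertices M"
  by (simp add: comaximal_graph_def)

section \<open>Atoms and prescribed zero sets\<close>

lemma atom_Int_or_Diff_null:
  assumes "atom M A" "S \<in> sets M"
  shows "emeasure M (A \<inter> S) = 0 \<or> emeasure M (A - S) = 0"
proof -
  have "A \<inter> S \<in> sets M" "A - S \<in> sets M" "A = (A \<inter> S) \<union> (A - S)" "(A \<inter> S) \<inter> (A - S) = {}"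
    using assms by (auto simp: atom_def)
  then show ?thesis
    using assms(1) unfolding atom_def zero_less_iff_neq_zero by blast
qed

text \<open>An atom has no two complementary non-null pieces, so \<open>S\<close> and
  \<open>T\<close> each contain almost all of \<open>A\<close>. If \<open>S \<inter> T\<close> were
  null, the null sets \<open>A - S\<close>, \<open>A - T\<close> and \<open>S \<inter> T\<close>
  would cover \<open>A\<close>.\<close>

lemma atom_Int_Int_pos:
  assumes A: "atom M A" and S: "S \<in> sets M" "T \<in> sets M"
    and pos: "emeasure M (A \<inter> S) > 0" "emeasure M (A \<inter> T) > 0"
  shows "emeasure M (S \<inter> T) > 0"
proof (rule ccontr)
  assume "\<not> ?thesis"
  then have "S \<inter> T \<in> null_sets M"
    using S by auto
  moreover have "A \<in> sets M"
    using A by (simp add: atom_def)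
  then have "A - S \<in> null_sets M" "A - T \<in> null_sets M"
    using atom_Int_or_Diff_null[OF A S(1)] atom_Int_or_Diff_null[OF A S(2)] S pos
    by (auto simp: null_sets_def)
  ultimately have "(A - S) \<union> (A - T) \<union> (S \<inter> T) \<in> null_sets M"
    by (intro null_sets.Un)
  moreover have "A \<subseteq> (A - S) \<union> (A - T) \<union> (S \<inter> T)"
    by blast
  ultimately have "emeasure M A = 0"
    by (meson emeasure_eq_0 null_setsD1 null_setsD2)
  then show False
    using A by (simp add: atom_def)
qed

text \<open>Supplies vertices with a prescribed zero set; varying \<open>c\<close> gives different
  vertices with the same zero set, as the 4-cycle requires.\<close>

lemma restrict_in_graph_vertices:
  assumes S: "S \<in> sets M" "emeasure M S > 0" "emeasure M (space M - S) > 0" and c: "c \<noteq> 0"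
  defines "f \<equiv> \<lambda>x\<in>space M. if x \<in> S then 0 else c"
  shows "f \<in> graph_vertices M" "zero_set M f = S"
proof -
  show Z: "zero_set M f = S"
    using c sets.sets_into_space[OF S(1)] by (auto simp: f_def zero_set_def)
  have "f \<in> carrier (meas_ring M)"
    unfolding f_def using S(1) by (intro restrict_in_meas_ring measurable_If_set) auto
  then show "f \<in> graph_vertices M"
    using S by (simp add: graph_vertices_def Z)
qed

section \<open>Short cycles and bounds on the girth\<close>

lemma cycle3:
  assumes "(f, g) \<in> parcs G" "(g, h) \<in> parcs G" "(h, f) \<in> parcs G" "f \<in> pverts G"
    "distinct [f, g, h]"
  shows "pre_digraph.cycle (with_proj G) [(f, g), (g, h), (h, f)]"
  using assms
  by (auto simp: pre_digraph.cycle_def pre_digraph.awalk_def awalk_verts_with_proj_eq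
      cas_with_proj_eq intro!: exI[of _ f])

lemma cycle4:
  assumes "(f, g) \<in> parcs G" "(g, h) \<in> parcs G" "(h, k) \<in> parcs G" "(k, f) \<in> parcs G"
    "f \<in> pverts G" "distinct [f, g, h, k]"
  shows "pre_digraph.cycle (with_proj G) [(f, g), (g, h), (h, k), (k, f)]"
  using assms
  by (auto simp: pre_digraph.cycle_def pre_digraph.awalk_def awalk_verts_with_proj_eq
      cas_with_proj_eq intro!: exI[of _ f])

lemma cycle_length_3E:
  assumes "pre_digraph.cycle (with_proj G) p" "length p = 3"
  obtains f g h where "(f, g) \<in> parcs G" "(g, h) \<in> parcs G" "(h, f) \<in> parcs G"
proof -
  obtain e1 e2 e3 where "p = [e1, e2, e3]"
    using assms(2) by (auto simp: numeral_3_eq_3 length_Suc_conv)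
  with assms(1) show thesis
    by (cases e1; cases e2; cases e3)
      (auto simp: pre_digraph.cycle_def pre_digraph.awalk_def cas_with_proj_eq intro: that)
qed

lemma girth_le_length:
  "pre_digraph.cycle (with_proj G) p \<Longrightarrow> 3 \<le> length p \<Longrightarrow> girth G \<le> enat (length p)"
  unfolding girth_def by (rule INF_lower) simp

text \<open>The infimum ranges only over cycles of length at least 3; if there are none, it is
  \<open>\<infinity>\<close>.\<close>

lemma three_le_girth: "3 \<le> girth G"
  unfolding girth_def by (rule INF_greatest) (simp add: numeral_eq_enat)

lemma four_le_girth:
  assumes "\<And>f g h. \<lbrakk>(f, g) \<in> parcs G; (g, h) \<in> parcs G; (h, f) \<in> parcs G\<rbrakk> \<Longrightarrow> False"
  shows "4 \<le> girth G"
  unfolding girth_def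
proof (rule INF_greatest)
  fix p assume p: "p \<in> {p. pre_digraph.cycle (with_proj G) p \<and> 3 \<le> length p}"
  then have "length p \<noteq> 3"
    using assms cycle_length_3E[of G p] by auto
  with p show "4 \<le> enat (length p)"
    by (simp add: numeral_eq_enat)
qed

section \<open>Spaces split into two atoms\<close>

lemma comaximal_graph_triangle_free:
  assumes A: "atom M A" and B: "atom M B" and X: "space M = A \<union> B"
    and arcs: "(f, g) \<in> parcs (comaximal_graph M)" "(g, h) \<in> parcs (comaximal_graph M)"
      "(h, f) \<in> parcs (comaximal_graph M)"
  shows False
proof -
  let ?S = "zero_set M f" and ?T = "zero_set M g" and ?U = "zero_set M h"
  have sets: "?S \<in> sets M" "?T \<in> sets M" "?U \<in> sets M"
    and null: "emeasure M (?S \<inter> ?T) = 0" "emeasure M (?T \<inter> ?U) = 0" "emeasure M (?U \<inter> ?S) = 0"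
    using arcs by (auto simp: parcs_comaximal_graph_iff graph_vertices_def zero_set_in_sets)
  \<comment> \<open>\<open>A\<close> and \<open>B\<close> cover the space, so a zero set that is
    null on both would be null, which is excluded for a vertex.\<close>
  have "emeasure M (A \<inter> zero_set M k) > 0 \<or> emeasure M (B \<inter> zero_set M k) > 0"
    if "k \<in> graph_vertices M" for k
  proof (rule ccontr)
    assume "\<not> ?thesis"
    moreover have k: "zero_set M k \<in> sets M" "emeasure M (zero_set M k) > 0"
      using that by (auto simp: graph_vertices_def zero_set_in_sets)
    moreover have "A \<in> sets M" "B \<in> sets M"
      using A B by (auto simp: atom_def)
    ultimately have "A \<inter> zero_set M k \<union> B \<inter> zero_set M k \<in> null_sets M"
      by (intro null_sets.Un) auto
    moreover have "A \<inter> zero_set M k \<union> B \<inter> zero_set M k = zero_set M k"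
      using X by (auto simp: zero_set_def)
    ultimately show False
      using k by auto
  qed
  moreover have "f \<in> graph_vertices M" "g \<in> graph_vertices M" "h \<in> graph_vertices M"
    using arcs by (auto simp: parcs_comaximal_graph_iff)
  \<comment> \<open>Two zero sets that are both non-null on one atom would meet in positive measure,
    against the arc between them. Three zero sets then cannot be distributed over two atoms.\<close>
  moreover have "\<not> (emeasure M (C \<inter> ?S) > 0 \<and> emeasure M (C \<inter> ?T) > 0)"
    "\<not> (emeasure M (C \<inter> ?T) > 0 \<and> emeasure M (C \<inter> ?U) > 0)"
    "\<not> (emeasure M (C \<inter> ?U) > 0 \<and> emeasure M (C \<inter> ?S) > 0)" if "atom M C" for C
    using atom_Int_Int_pos[OF that] sets null by fastforce+
  ultimately show False
    using A B by blast
qed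

lemma girth_two_atoms:
  assumes A: "atom M A" and B: "atom M B" and X: "A \<inter> B = {}" "space M = A \<union> B"
  shows "girth (comaximal_graph M) = 4"
proof (rule antisym)
  \<comment> \<open>The values 1 and 2 of \<open>c\<close> yield two vertices for each atom. The
    cycle alternates between zero sets \<open>A\<close> and \<open>B\<close>, which are
    disjoint.\<close>
  define F where "F S c = (\<lambda>x\<in>space M. if x \<in> S then 0 else c)" for S and c :: real
  have "space M - A = B" "space M - B = A"
    using X by auto
  then have V: "F S c \<in> graph_vertices M \<and> zero_set M (F S c) = S"
    if "S \<in> {A, B}" "c \<noteq> 0" for S c
    using restrict_in_graph_vertices[of S M c] A B that by (auto simp: F_def atom_def)
  have ne: "A \<noteq> {}" "B \<noteq> {}" "A \<noteq> B"
    using A B X by (auto simp: atom_def)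
  have VA: "F A c \<in> graph_vertices M" "zero_set M (F A c) = A"
    and VB: "F B c \<in> graph_vertices M" "zero_set M (F B c) = B" if "c \<noteq> 0" for c
    using V that by auto
  have "F A 1 \<noteq> F A 2" "F B 1 \<noteq> F B 2"
    using ne X by (auto simp: F_def fun_eq_iff restrict_def)
  moreover have "F A c \<noteq> F B d" if "c \<noteq> 0" "d \<noteq> 0" for c d
    using VA(2)[of c] VB(2)[of d] ne that by auto
  ultimately have "distinct [F A 1, F B 1, F A 2, F B 2]"
    by (auto simp: eq_commute[of "F B _" "F A _"])
  then have "pre_digraph.cycle (with_proj (comaximal_graph M))
      [(F A 1, F B 1), (F B 1, F A 2), (F A 2, F B 2), (F B 2, F A 1)]"
    using VA VB X(1)
    by (intro cycle4) (simp_all add: parcs_comaximal_graph_iff Int_commute)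
  from girth_le_length[OF this] show "girth (comaximal_graph M) \<le> 4"
    by (simp add: numeral_eq_enat eval_nat_numeral)
  show "4 \<le> girth (comaximal_graph M)"
    using comaximal_graph_triangle_free[OF A B X(2)] by (rule four_le_girth)
qed

section \<open>Spaces with three disjoint non-null sets\<close>

lemma girth_three_parts:
  assumes "P \<in> sets M" "Q \<in> sets M" "R \<in> sets M"
    and "emeasure M P > 0" "emeasure M Q > 0" "emeasure M R > 0"
    and disj: "P \<inter> Q = {}" "Q \<inter> R = {}" "R \<inter> P = {}"
  shows "girth (comaximal_graph M) = 3"
proof (rule antisym)
  define F where "F S = (\<lambda>x\<in>space M. if x \<in> S then 0 else 1 :: real)" for S
  \<comment> \<open>The set \<open>T\<close> is a witness that the complement of \<open>S\<close> is
    not null; each of \<open>P\<close>, \<open>Q\<close>, \<open>R\<close> takes the next one in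
    cyclic order as its \<open>T\<close>.\<close>
  have V: "F S \<in> graph_vertices M \<and> zero_set M (F S) = S"
    if "S \<in> sets M" "emeasure M S > 0" "T \<in> sets M" "emeasure M T > 0" "S \<inter> T = {}" for S T
  proof -
    have "T \<subseteq> space M - S"
      using that sets.sets_into_space[of T M] by auto
    then have "emeasure M (space M - S) > 0"
      using that by (meson emeasure_mono less_le_trans sets.compl_sets)
    then show ?thesis
      using that restrict_in_graph_vertices[of S M 1] by (simp add: F_def)
  qed
  have VP: "F P \<in> graph_vertices M" "zero_set M (F P) = P"
    and VQ: "F Q \<in> graph_vertices M" "zero_set M (F Q) = Q"
    and VR: "F R \<in> graph_vertices M" "zero_set M (F R) = R"
    using V[of P Q] V[of Q R] V[of R P] assms by simp_all
  have "P \<noteq> Q" "Q \<noteq> R" "R \<noteq> P"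
    using assms by auto
  then have "F P \<noteq> F Q" "F Q \<noteq> F R" "F R \<noteq> F P"
    using VP(2) VQ(2) VR(2) by metis+
  then have "pre_digraph.cycle (with_proj (comaximal_graph M))
      [(F P, F Q), (F Q, F R), (F R, F P)]"
    using VP VQ VR disj
    by (intro cycle3) (simp_all add: parcs_comaximal_graph_iff)
  from girth_le_length[OF this] show "girth (comaximal_graph M) \<le> 3"
    by (simp add: numeral_eq_enat eval_nat_numeral)
qed (rule three_le_girth)

theorem corollary3p16:
  fixes M :: "'a measure"
  assumes "emeasure M (space M) > 0"
    and "\<not> atom M (space M)"
  shows "girth (comaximal_graph M) =
    (if \<exists>A B. atom M A \<and> atom M B \<and> A \<inter> B = {} \<and> space M = A \<union> B then 4 else 3)"
proof (cases "\<exists>A B. atom M A \<and> atom M B \<and> A \<inter> B = {} \<and> space M = A \<union> B")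
  case True
  then show ?thesis
    using girth_two_atoms by auto
next
  case False
  \<comment> \<open>A non-null set that is not an atom splits into two non-null pieces, which
    together with \<open>D\<close> give three disjoint sets.\<close>
  have three: "girth (comaximal_graph M) = 3"
    if "C \<in> sets M" "D \<in> sets M" "C \<inter> D = {}" "emeasure M C > 0" "emeasure M D > 0"
      and C: "\<not> atom M C" for C D
  proof -
    obtain P Q where "P \<in> sets M" "Q \<in> sets M" "C = P \<union> Q" "P \<inter> Q = {}"
      "emeasure M P > 0" "emeasure M Q > 0"
      using C \<open>C \<in> sets M\<close> \<open>emeasure M C > 0\<close> unfolding atom_def by blast
    then show ?thesis
      using that by (intro girth_three_parts[of P M Q D]) auto
  qed
  \<comment> \<open>Since the space is not an atom, it splits once; as the two pieces are not both
    atoms, one of them splits again.\<close>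
  obtain B C where BC: "B \<in> sets M" "C \<in> sets M" "space M = B \<union> C" "B \<inter> C = {}"
    "emeasure M B > 0" "emeasure M C > 0"
    using assms unfolding atom_def by blast
  with False have "\<not> atom M B \<or> \<not> atom M C"
    by blast
  then have "girth (comaximal_graph M) = 3"
    using BC three[of B C] three[of C B] by auto
  with False show ?thesis
    by simp
qed

end
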